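(* Let $G$ be the pendant graph with nodes $1,2,3,4$ and edges $12,13,23,34$. For $\lambda\in\mathrm{Ncond}(G)$ put $$\alpha(\lambda)=\left[1+\frac{\lambda_1}{\lambda_3+\lambda_2-\lambda_1}+\frac{\lambda_2}{\lambda_3+\lambda_1-\lambda_2}\right]^{-1}.$$ Then the following inclusion is strict: $$\{\lambda:\ \lambda_4<\alpha(\lambda)\lambda_3\}\cap\mathrm{Ncond}(G)\subsetneq\mathrm{Ncond}(G).$$
   Context: $\mathrm{Ncond}(G)$ is the set of $\lambda\in(0,\infty)^{4}$ such that $\sum_{i\in\mathcal I}\lambda_i<\sum_{j\in\mathcal E(\mathcal I)}\lambda_j$ for every non-empty independent set $\mathcal I$ of $G$, where $\mathcal E(\mathcal I)$ is the set of nodes adjacent to some node of $\mathcal I$. For the pendant graph it amounts to $\lambda_4<\lambda_3<\lambda_4+\lambda_1+\lambda_2$, $\lambda_4+\lambda_1<\lambda_3+\lambda_2$ and $\lambda_4+\lambda_2<\lambda_3+\lambda_1$. *)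

theory Defs
  imports "HOL-Analysis.Analysis"
begin

text \<open>
  A finite simple graph is given by its set of edges, which are two-element sets of nodes; the
  node set is the whole finite type.
\<close>

definition independent_set :: "'n set set \<Rightarrow> 'n set \<Rightarrow> bool" where
  "independent_set E I \<longleftrightarrow> (\<forall>u\<in>I. \<forall>v\<in>I. {u, v} \<notin> E)"

definition neighbours :: "'n set set \<Rightarrow> 'n set \<Rightarrow> 'n set" where
  "neighbours E I = {v. \<exists>u\<in>I. {u, v} \<in> E}"

definition Ncond :: "'n::finite set set \<Rightarrow> (real ^ 'n) set" where
  "Ncond E = {l. (\<forall>i. 0 < l $ i) \<and>
     (\<forall>I. I \<noteq> {} \<and> independent_set E I \<longrightarrow>
        (\<Sum>i\<in>I. l $ i) < (\<Sum>j\<in>neighbours E I. l $ j))}"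

text \<open>
  The four elements of the numeral type \<^typ>\<open>4\<close> are \<open>1, 2, 3, 4\<close>, pairwise distinct
  (arithmetic is modulo four, so that \<open>4\<close> is also written \<open>0\<close>).
\<close>

definition pendant_graph :: "4 set set" where
  "pendant_graph = {{1, 2}, {1, 3}, {2, 3}, {3, 4}}"

definition alpha :: "real ^ 4 \<Rightarrow> real" where
  "alpha l = inverse (1 + l $ 1 / (l $ 3 + l $ 2 - l $ 1) + l $ 2 / (l $ 3 + l $ 1 - l $ 2))"

end

theory Submission
  imports Defs
begin

text \<open>The inclusion is trivial, so strictness needs one point of
  \<open>Ncond pendant_graph\<close> with \<open>l $ 4 \<ge> alpha l * l $ 3\<close>. Once the
  independent sets are listed (\<open>independent_set_pendant_graph\<close>), membership reduces to
  a few linear inequalities (\<open>Ncond_pendant_graphI\<close>), and an explicit vector settles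
  the matter.\<close>

lemma pendant_graph_edge_iff:
  "{u, v} \<in> pendant_graph \<longleftrightarrow>
     (u, v) \<in> {(1, 2), (2, 1), (1, 3), (3, 1), (2, 3), (3, 2), (3, 4), (4, 3)}"
  unfolding pendant_graph_def by (auto simp: doubleton_eq_iff)

lemma neighbours_pendant_graph:
  "neighbours pendant_graph {1} = {2, 3}"
  "neighbours pendant_graph {2} = {1, 3}"
  "neighbours pendant_graph {3} = {1, 2, 4}"
  "neighbours pendant_graph {4} = {3}"
  "neighbours pendant_graph {1, 4} = {2, 3}"
  "neighbours pendant_graph {2, 4} = {1, 3}"
  unfolding neighbours_def pendant_graph_edge_iff by auto

text \<open>The triangle 1, 2, 3 contributes at most one node, and node 4 excludes only node
  3.\<close>

lemma independent_set_pendant_graph: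
  assumes "independent_set pendant_graph I" "I \<noteq> {}"
  shows "I \<in> {{1}, {2}, {3}, {4}, {1, 4}, {2, 4}}"
proof -
  have no_edge: "\<not> (1 \<in> I \<and> 2 \<in> I)" "\<not> (1 \<in> I \<and> 3 \<in> I)" "\<not> (2 \<in> I \<and> 3 \<in> I)" "\<not> (3 \<in> I \<and> 4 \<in> I)"
    using assms(1) unfolding independent_set_def pendant_graph_edge_iff by blast+
  have "I \<in> Pow {1, 2, 3, 4}"
    using UNIV_4 by auto
  \<comment> \<open>In this form, each of the sixteen membership patterns determines
    \<open>I\<close> explicitly.\<close>
  then have "I = {x. x = 1 \<and> 1 \<in> I \<or> x = 2 \<and> 2 \<in> I \<or> x = 3 \<and> 3 \<in> I \<or> x = 4 \<and> 4 \<in> I}"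
    by blast
  with no_edge assms(2) show ?thesis
    by (cases "1 \<in> I"; cases "2 \<in> I"; cases "3 \<in> I"; cases "4 \<in> I") (simp_all, blast+)
qed

lemma Ncond_pendant_graphI:
  assumes "\<And>i. 0 < l $ i"
    and "l $ 4 < l $ 3" "l $ 3 < l $ 4 + l $ 1 + l $ 2"
    and "l $ 4 + l $ 1 < l $ 3 + l $ 2" "l $ 4 + l $ 2 < l $ 3 + l $ 1"
  shows "l \<in> Ncond pendant_graph"
proof -
  have "(\<Sum>i\<in>I. l $ i) < (\<Sum>j\<in>neighbours pendant_graph I. l $ j)"
    if "I \<noteq> {}" "independent_set pendant_graph I" for I
    \<comment> \<open>Adding node 4 to \<open>{1}\<close> or \<open>{2}\<close> leaves the
      neighbours unchanged, so the singleton conditions follow from those for the pairs by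
      positivity of \<open>l $ 4\<close>.\<close>
    using independent_set_pendant_graph[OF that(2,1)] assms(1)[of 4] assms(2-)
    by (auto simp: neighbours_pendant_graph)
  with assms(1) show ?thesis
    unfolding Ncond_def by blast
qed

theorem proposition3:
  "{l. l $ 4 < alpha l * l $ 3} \<inter> Ncond pendant_graph \<subset> Ncond pendant_graph"
proof -
  \<comment> \<open>With first coordinates 1, 1, 2, \<open>Ncond\<close> amounts to
    \<open>0 < l $ 4 < 2\<close>, while \<open>alpha l = 1 / 2\<close> gives the threshold 1; so any
    value in [1, 2) works, and 3/2 is one.\<close>
  define l :: "real ^ 4" where "l = (\<chi> i. if i = 3 then 2 else if i = 4 then 3 / 2 else 1)"
  have vals: "l $ 1 = 1" "l $ 2 = 1" "l $ 3 = 2" "l $ 4 = 3 / 2"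
    by (simp_all add: l_def)
  have "l \<in> Ncond pendant_graph"
    by (rule Ncond_pendant_graphI) (simp_all add: vals, simp add: l_def)
  moreover have "\<not> l $ 4 < alpha l * l $ 3"
    unfolding alpha_def vals by simp
  ultimately show ?thesis
    by blast
qed

end
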